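(* Let $\omega=\frac{-1+\sqrt{-3}}{2}$. For every rational number $\alpha$, $\mathcal{R}_\alpha(\omega)$ and $\mathcal{S}_\alpha(\omega)$ belong to $\{0,\pm1,\pm\omega,\pm\omega^2\}$.
   Context: For an integer $c$, $[c]_q=\frac{1-q^c}{1-q}$ (a Laurent polynomial). Every rational $\alpha>1$ has a unique negative continued fraction expansion $\alpha=c_1-\cfrac{1}{c_2-\cfrac{1}{\ddots-\cfrac{1}{c_l}}}$ with integers $c_j\ge 2$. Put $M^-_q(c)=\begin{pmatrix}[c]_q & -q^{c-1}\\ 1 & 0\end{pmatrix}$ and define $\mathcal{R}_\alpha(q),\mathcal{S}_\alpha(q)$ by $\begin{pmatrix}\mathcal{R}_\alpha(q)\\ \mathcal{S}_\alpha(q)\end{pmatrix}=M^-_q(c_1)\cdots M^-_q(c_l)\begin{pmatrix}1\\0\end{pmatrix}$. For rational $\alpha\le 1$ they are defined recursively by $\mathcal{S}_\alpha(q)=\mathcal{S}_{\alpha+1}(q)$ and $\mathcal{R}_\alpha(q)=q^{-1}(\mathcal{R}_{\alpha+1}(q)-\mathcal{S}_{\alpha+1}(q))$, so they are Laurent polynomials in $q$ with integer coefficients. *)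

theory Defs
  imports "HOL-Analysis.Analysis" "HOL-Library.Poly_Mapping"
begin

text \<open>
  The ring of integral Laurent polynomials in one variable \<open>q\<close> is the group ring of the additive
  group of integers: \<^term>\<open>Poly_Mapping.lookup p k\<close> is the coefficient of \<open>q\<close> to the power \<open>k\<close>, and
  multiplication of finitely supported maps is convolution.
\<close>

type_synonym laurent = "int \<Rightarrow>\<^sub>0 int"

definition q_pow :: "int \<Rightarrow> laurent" where
  "q_pow k = Poly_Mapping.single k 1"

definition laurent_eval :: "laurent \<Rightarrow> complex \<Rightarrow> complex" where
  "laurent_eval p z = (\<Sum>k\<in>Poly_Mapping.keys p. of_int (Poly_Mapping.lookup p k) * z powi k)"

text \<open>
  The quotient of \<open>1 - q\<^sup>c\<close> by \<open>1 - q\<close>, written out; \<open>q_int_quotient\<close> and \<open>q_int_unique\<close> below show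
  that this is that quotient.
\<close>

definition q_int :: "int \<Rightarrow> laurent" where
  "q_int c = (if c \<ge> 0 then (\<Sum>k\<in>{0..<c}. q_pow k) else - (\<Sum>k\<in>{c..<0}. q_pow k))"

lemma q_pow_mult: "q_pow a * q_pow b = q_pow (a + b)"
  by (simp add: q_pow_def Poly_Mapping.mult_single)

lemma q_pow_0: "q_pow 0 = 1"
  by (simp add: q_pow_def)

lemma sum_q_pow: "(1 - q_pow 1) * (\<Sum>k\<in>{a..<a + int n}. q_pow k) = q_pow a - q_pow (a + int n)"
proof (induction n)
  case 0
  then show ?case by simp
next
  case (Suc n)
  have "{a..<a + int (Suc n)} = insert (a + int n) {a..<a + int n}" by auto
  then have "(\<Sum>k\<in>{a..<a + int (Suc n)}. q_pow k) = q_pow (a + int n) + (\<Sum>k\<in>{a..<a + int n}. q_pow k)"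
    by simp
  then have "(1 - q_pow 1) * (\<Sum>k\<in>{a..<a + int (Suc n)}. q_pow k) =
      (1 - q_pow 1) * q_pow (a + int n) + (q_pow a - q_pow (a + int n))"
    by (simp only: distrib_left Suc)
  also have "\<dots> = q_pow a - q_pow (a + int (Suc n))"
    by (simp add: left_diff_distrib q_pow_mult add_ac)
  finally show ?case .
qed

lemma q_int_quotient: "(1 - q_pow 1) * q_int c = 1 - q_pow c"
proof (cases "c \<ge> 0")
  case True
  then show ?thesis using sum_q_pow[of 0 "nat c"] by (simp add: q_int_def q_pow_0)
next
  case False
  then show ?thesis using sum_q_pow[of c "nat (- c)"] by (simp add: q_int_def q_pow_0)
qed

lemma q_int_unique: "(1 - q_pow 1) * p = 1 - q_pow c \<Longrightarrow> p = q_int c"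
proof -
  assume p: "(1 - q_pow 1) * p = 1 - q_pow c"
  have "Poly_Mapping.lookup (1 - q_pow 1) 0 \<noteq> (0 :: int)"
    by (simp add: q_pow_def lookup_minus lookup_single lookup_one)
  then have "1 - q_pow 1 \<noteq> 0" by (metis lookup_zero)
  then show ?thesis using p q_int_quotient[of c] by (metis mult_left_cancel)
qed

text \<open>The value at the empty list is a dummy and plays no role.\<close>

fun neg_cf :: "int list \<Rightarrow> rat" where
  "neg_cf [] = 0"
| "neg_cf [c] = of_int c"
| "neg_cf (c # d # cs) = of_int c - 1 / neg_cf (d # cs)"

definition is_neg_cf :: "int list \<Rightarrow> rat \<Rightarrow> bool" where
  "is_neg_cf cs \<alpha> \<longleftrightarrow> cs \<noteq> [] \<and> (\<forall>c\<in>set cs. c \<ge> 2) \<and> neg_cf cs = \<alpha>"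

lemma neg_cf_gt_1: "cs \<noteq> [] \<Longrightarrow> \<forall>c\<in>set cs. c \<ge> 2 \<Longrightarrow> neg_cf cs > 1"
proof (induction cs rule: neg_cf.induct)
  case (3 c d cs)
  then have "neg_cf (d # cs) > 1" by simp
  then have "1 / neg_cf (d # cs) < 1" by simp
  moreover have "(of_int c :: rat) \<ge> 2" using 3 by simp
  ultimately show ?case by (simp only: neg_cf.simps)
qed auto

lemma neg_cf_ceiling: "\<forall>c\<in>set (c # cs). c \<ge> 2 \<Longrightarrow> \<lceil>neg_cf (c # cs)\<rceil> = c"
proof (cases cs)
  case (Cons d ds)
  assume "\<forall>c\<in>set (c # cs). c \<ge> 2"
  then have "neg_cf (d # ds) > 1" using Cons by (intro neg_cf_gt_1) auto
  then have "1 / neg_cf (d # ds) < 1" "1 / neg_cf (d # ds) > 0" by auto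
  then show ?thesis using Cons by (simp add: ceiling_eq_iff)
qed simp

lemma neg_cf_inj:
  "cs \<noteq> [] \<Longrightarrow> ds \<noteq> [] \<Longrightarrow> \<forall>c\<in>set cs. c \<ge> 2 \<Longrightarrow> \<forall>c\<in>set ds. c \<ge> 2 \<Longrightarrow>
     neg_cf cs = neg_cf ds \<Longrightarrow> cs = ds"
proof (induction cs arbitrary: ds rule: neg_cf.induct)
  case (2 c)
  then obtain d ds' where ds: "ds = d # ds'" by (cases ds) auto
  have "\<lceil>neg_cf ds\<rceil> = d" using neg_cf_ceiling[of d ds'] 2 ds by auto
  moreover have "neg_cf ds = of_int c" using 2 by simp
  ultimately have "c = d" by simp
  then show ?case
    using 2 ds neg_cf_gt_1[of ds'] by (cases ds') auto
next
  case (3 c c' cs)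
  then obtain d ds' where ds: "ds = d # ds'" by (cases ds) auto
  have gt: "neg_cf (c' # cs) > 1" using 3 by (intro neg_cf_gt_1) auto
  have cd: "c = d" using neg_cf_ceiling[of d ds'] neg_cf_ceiling[of c "c' # cs"] 3 ds by metis
  show ?case
  proof (cases ds')
    case Nil
    then show ?thesis using 3 ds cd gt by auto
  next
    case (Cons d' es)
    then have "neg_cf (c' # cs) = neg_cf (d' # es)" using 3 ds cd by auto
    then have "c' # cs = d' # es" using 3 ds Cons by (intro "3.IH") auto
    then show ?thesis using ds cd Cons by simp
  qed
qed simp

lemma neg_cf_exists_aux:
  "0 < n \<Longrightarrow> int n < a \<Longrightarrow> \<exists>cs. is_neg_cf cs (of_int a / of_nat n)"
proof (induction n arbitrary: a rule: less_induct)
  case (less n)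
  define c where "c = - ((- a) div int n)"
  define r where "r = nat ((- a) mod int n)"
  have r: "int r = (- a) mod int n" using less.prems by (simp add: r_def)
  then have rn: "r < n" using less.prems
    by (metis Euclidean_Rings.pos_mod_bound of_nat_0_less_iff of_nat_less_iff)
  have eq: "a = c * int n - int r"
    using div_mult_mod_eq[of "- a" "int n"] unfolding r c_def by linarith
  have "c * int n > 1 * int n" using eq less.prems by linarith
  then have c2: "c \<ge> 2" using less.prems(1) mult_less_cancel_right[of 1 "int n" c] by linarith
  have eq': "(of_int a :: rat) / of_nat n = of_int c - of_nat r / of_nat n"
    using less.prems by (simp add: eq field_simps)
  show ?case
  proof (cases "r = 0")
    case True
    then have "is_neg_cf [c] (of_int a / of_nat n)" using eq' c2 by (simp add: is_neg_cf_def)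
    then show ?thesis ..
  next
    case False
    then obtain cs where cs: "is_neg_cf cs (of_int (int n) / of_nat r)"
      using less.IH[of r "int n"] rn by auto
    then obtain d ds where "cs = d # ds" by (cases cs) (auto simp: is_neg_cf_def)
    then have "is_neg_cf (c # cs) (of_int a / of_nat n)"
      using cs eq' c2 by (auto simp: is_neg_cf_def)
    then show ?thesis ..
  qed
qed

lemma neg_cf_ex1:
  assumes "\<alpha> > 1"
  shows "\<exists>!cs. is_neg_cf cs \<alpha>"
proof -
  obtain a b where ab: "\<alpha> = of_int a / of_int b" "b > 0"
    by (metis Fract_of_int_quotient Rat_cases)
  then have "(of_int b :: rat) < of_int a" using assms by (simp add: less_divide_eq)
  then have "b < a" by simp
  then have "\<exists>cs. is_neg_cf cs \<alpha>" using neg_cf_exists_aux[of "nat b" a] ab by auto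
  then show ?thesis using neg_cf_inj unfolding is_neg_cf_def by metis
qed

definition neg_cf_expansion :: "rat \<Rightarrow> int list" where
  "neg_cf_expansion \<alpha> = (THE cs. is_neg_cf cs \<alpha>)"

lemma is_neg_cf_expansion: "\<alpha> > 1 \<Longrightarrow> is_neg_cf (neg_cf_expansion \<alpha>) \<alpha>"
  unfolding neg_cf_expansion_def by (rule theI') (rule neg_cf_ex1)

definition M_minus :: "int \<Rightarrow> laurent ^ 2 ^ 2" where
  "M_minus c = vector [vector [q_int c, - q_pow (c - 1)], vector [1, 0]]"

definition RS_vec :: "int list \<Rightarrow> laurent ^ 2" where
  "RS_vec cs = foldr (**) (map M_minus cs) (mat 1) *v vector [1, 0]"

function S_q :: "rat \<Rightarrow> laurent" where
  "S_q \<alpha> = (if \<alpha> > 1 then RS_vec (neg_cf_expansion \<alpha>) $ 2 else S_q (\<alpha> + 1))"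
  by auto
termination
  by (relation "Wellfounded.measure (\<lambda>\<alpha>. nat \<lceil>2 - \<alpha>\<rceil>)") (auto simp: nat_less_iff, linarith+)

function R_q :: "rat \<Rightarrow> laurent" where
  "R_q \<alpha> = (if \<alpha> > 1 then RS_vec (neg_cf_expansion \<alpha>) $ 1
            else q_pow (-1) * (R_q (\<alpha> + 1) - S_q (\<alpha> + 1)))"
  by auto
termination
  by (relation "Wellfounded.measure (\<lambda>\<alpha>. nat \<lceil>2 - \<alpha>\<rceil>)") (auto simp: nat_less_iff, linarith+)

declare S_q.simps [simp del] R_q.simps [simp del]

end

theory Submission
  imports Defs
begin

text \<open>
  Up to a common factor in \<open>{\<plusminus>1, \<plusminus>\<omega>, \<plusminus>\<omega>\<^sup>2}\<close>, the vectors \<open>(1, 0)\<close>, \<open>(0, 1)\<close>, \<open>(1, 1)\<close> and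
  \<open>(-\<omega>\<^sup>2, 1)\<close> are permuted by every matrix \<open>M\<^sup>-(c)\<close> at \<open>q = \<omega>\<close>, which depends only on \<open>c\<close> modulo 3,
  and by the map \<open>(r, s) \<mapsto> (\<omega>\<^sup>-\<^sup>1(r - s), s)\<close> of the shift \<open>\<alpha> + 1 \<mapsto> \<alpha>\<close>. The orbit of
  \<open>(1, 0)\<close> therefore stays among the multiples of these four vectors.
\<close>

lemma laurent_eval_superset:
  assumes "finite A" "Poly_Mapping.keys p \<subseteq> A"
  shows "laurent_eval p z = (\<Sum>k\<in>A. of_int (Poly_Mapping.lookup p k) * z powi k)"
  unfolding laurent_eval_def
  by (rule sum.mono_neutral_left) (use assms in \<open>auto simp: in_keys_iff\<close>)

lemma laurent_eval_0 [simp]: "laurent_eval 0 z = 0"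
  by (simp add: laurent_eval_def)

lemma laurent_eval_q_pow [simp]: "laurent_eval (q_pow k) z = z powi k"
  by (simp add: laurent_eval_def q_pow_def)

lemma laurent_eval_1 [simp]: "laurent_eval 1 z = 1"
  using laurent_eval_q_pow[of 0 z] by (simp add: q_pow_0)

lemma laurent_eval_add: "laurent_eval (p + r) z = laurent_eval p z + laurent_eval r z"
proof -
  let ?A = "Poly_Mapping.keys p \<union> Poly_Mapping.keys r"
  have "Poly_Mapping.keys (p + r) \<subseteq> ?A" by (rule Poly_Mapping.keys_add)
  then show ?thesis
    by (simp add: laurent_eval_superset[of ?A] lookup_add distrib_right sum.distrib)
qed

lemma laurent_eval_uminus: "laurent_eval (- p) z = - laurent_eval p z"
  using laurent_eval_add[of p "- p" z] by (simp add: eq_neg_iff_add_eq_0 add.commute)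

lemma laurent_eval_diff: "laurent_eval (p - r) z = laurent_eval p z - laurent_eval r z"
  using laurent_eval_add[of p "- r" z] by (simp add: laurent_eval_uminus)

lemma laurent_eval_sum: "laurent_eval (\<Sum>i\<in>A. f i) z = (\<Sum>i\<in>A. laurent_eval (f i) z)"
  by (induction A rule: infinite_finite_induct) (auto simp: laurent_eval_add)

lemma laurent_eval_single [simp]:
  "laurent_eval (Poly_Mapping.single k a) z = of_int a * z powi k"
  by (cases "a = 0") (auto simp: laurent_eval_def)

lemma laurent_sum_single:
  "(p :: laurent) = (\<Sum>k\<in>Poly_Mapping.keys p. Poly_Mapping.single k (Poly_Mapping.lookup p k))"
  by (rule poly_mapping_eqI) (auto simp: lookup_sum lookup_single when_def in_keys_iff)

text \<open>By bilinearity it suffices to treat monomials, where the claim is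
  \<open>power_int_add\<close>. At \<open>z = 0\<close> it would fail:
  \<open>q_pow 1 * q_pow (-1)\<close> is 1, but both factors vanish there.\<close>

lemma laurent_eval_mult:
  assumes "z \<noteq> 0"
  shows "laurent_eval (p * r) z = laurent_eval p z * laurent_eval r z"
proof -
  have "laurent_eval (p * r) z = laurent_eval
      ((\<Sum>k\<in>Poly_Mapping.keys p. Poly_Mapping.single k (Poly_Mapping.lookup p k)) *
       (\<Sum>k\<in>Poly_Mapping.keys r. Poly_Mapping.single k (Poly_Mapping.lookup r k))) z"
    by (simp only: laurent_sum_single[symmetric])
  also have "\<dots> = laurent_eval p z * laurent_eval r z"
    unfolding sum_product
    by (simp add: laurent_eval_sum mult_single power_int_add assms laurent_eval_def[of p]
        laurent_eval_def[of r] sum_product mult_ac)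
  finally show ?thesis .
qed

text \<open>Evaluating the identity \<open>q_int_quotient\<close> avoids a case split on the sign of
  \<open>c\<close>.\<close>

lemma laurent_eval_q_int:
  assumes "z \<noteq> 0" "z \<noteq> 1"
  shows "laurent_eval (q_int c) z = (1 - z powi c) / (1 - z)"
proof -
  have "laurent_eval ((1 - q_pow 1) * q_int c) z = laurent_eval (1 - q_pow c) z"
    by (simp only: q_int_quotient)
  then show ?thesis
    using assms by (simp add: laurent_eval_mult laurent_eval_diff field_simps)
qed

lemma RS_vec_Nil: "RS_vec [] $ 1 = 1" "RS_vec [] $ 2 = 0"
  by (simp_all add: RS_vec_def)

lemma RS_vec_Cons:
  "RS_vec (c # cs) $ 1 = q_int c * RS_vec cs $ 1 - q_pow (c - 1) * RS_vec cs $ 2"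
  "RS_vec (c # cs) $ 2 = RS_vec cs $ 1"
proof -
  have "RS_vec (c # cs) = M_minus c *v RS_vec cs"
    by (simp add: RS_vec_def matrix_vector_mul_assoc)
  then show
    "RS_vec (c # cs) $ 1 = q_int c * RS_vec cs $ 1 - q_pow (c - 1) * RS_vec cs $ 2"
    "RS_vec (c # cs) $ 2 = RS_vec cs $ 1"
    by (simp_all add: M_minus_def matrix_vector_mult_def sum_2)
qed

text \<open>For a primitive cube root of unity \<open>w\<close>, the equation
  \<open>u ^ 6 = 1\<close> describes the six units of the overview in a form stable under products;
  the explicit list returns only in \<open>admissible_imp_mem\<close>.\<close>

definition admissible :: "complex \<Rightarrow> complex \<times> complex \<Rightarrow> bool" where
  "admissible w x \<longleftrightarrow> (\<exists>u. u ^ 6 = 1 \<and>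
     (x = (u, 0) \<or> x = (0, u) \<or> x = (u, u) \<or> x = (-(w\<^sup>2) * u, u)))"

context
  fixes w :: complex
  assumes w: "w\<^sup>2 = - 1 - w"
begin

lemma w_cube: "w ^ 3 = 1"
proof -
  have "w ^ 3 = w * w\<^sup>2" by (simp add: power3_eq_cube power2_eq_square)
  also have "\<dots> = - w - w\<^sup>2" by (simp add: w algebra_simps power2_eq_square[symmetric])
  finally show ?thesis by (simp add: w)
qed

text \<open>Reduces every polynomial in \<open>w\<close> to degree at most 1; the second form
  reaches squares inside right-nested products.\<close>

lemma w_mult: "w * w = - 1 - w" "w * (w * x) = (- 1 - w) * x"
  using w by (simp_all add: power2_eq_square mult.assoc[symmetric])

lemma w_nonzero: "w \<noteq> 0" and w_neq_1: "w \<noteq> 1"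
  using w by auto

lemma w_powi_mod3: "w powi c = w powi (c mod 3)"
proof -
  have "w powi c = w powi (3 * (c div 3) + c mod 3)" by simp
  also have "\<dots> = (w powi 3) powi (c div 3) * w powi (c mod 3)"
    by (simp only: power_int_add[OF disjI1[OF w_nonzero]] power_int_mult)
  finally show ?thesis by (simp add: w_cube)
qed

lemma w_pow_6: "w ^ 6 = 1"
  using w_cube power_mult[of w 3 2] by simp

lemma w_sq_pow_6: "(w\<^sup>2) ^ 6 = 1"
proof -
  have "(w\<^sup>2) ^ 6 = (w ^ 6)\<^sup>2" by (simp flip: power_mult)
  then show ?thesis by (simp add: w_pow_6)
qed

text \<open>A map may change the unit along with the type of vector. Here \<open>u\<close> is the
  old unit and \<open>v\<close> the new one.\<close>

lemma admissibleI:
  assumes "u ^ 6 = 1" "v \<in> {u, -u, w\<^sup>2 * u, -(w\<^sup>2) * u, -w * u}"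
    and "x = v \<and> y = 0 \<or> x = 0 \<and> y = v \<or> x = v \<and> y = v \<or> x = -(w\<^sup>2) * v \<and> y = v"
  shows "admissible w (x, y)"
proof -
  have "v ^ 6 = 1"
    using assms(1,2) by (auto simp: power_mult_distrib w_pow_6 w_sq_pow_6
        simp del: power_mult_numeral)
  then show ?thesis using assms(3) unfolding admissible_def by blast
qed

lemma admissible_M_minus:
  assumes "admissible w (a, b)"
  shows "admissible w ((1 - w powi c) / (1 - w) * a - w powi (c - 1) * b, a)"
proof -
  \<comment> \<open>As the inverse of \<open>w\<close> is its square, all matrix entries become
    functions of \<open>w powi c\<close>.\<close>
  have inv: "w powi (c - 1) = w\<^sup>2 * w powi c"
  proof -
    have "w\<^sup>2 * w powi c = w ^ 3 * w powi (c - 1)"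
      using w_nonzero by (simp add: power_int_diff power3_eq_cube power2_eq_square)
    then show ?thesis by (simp add: w_cube)
  qed
  have "c mod 3 \<in> {0, 1, 2}" by auto
  moreover have "(1 - w\<^sup>2) / (1 - w) = 1 + w"
    using w_neq_1 by (simp add: field_simps power2_eq_square)
  ultimately have "(w powi c, (1 - w powi c) / (1 - w)) \<in> {(1, 0), (w, 1), (w\<^sup>2, 1 + w)}"
    using w_neq_1 by (subst (1 2) w_powi_mod3) auto
  then consider (0) "w powi c = 1" "(1 - w powi c) / (1 - w) = 0"
    | (1) "w powi c = w" "(1 - w powi c) / (1 - w) = 1"
    | (2) "w powi c = w\<^sup>2" "(1 - w powi c) / (1 - w) = 1 + w"
    by auto
  note c_cases = this
  obtain u where u: "u ^ 6 = 1"
    and ab: "(a, b) = (u, 0) \<or> (a, b) = (0, u) \<or> (a, b) = (u, u) \<or> (a, b) = (-(w\<^sup>2) * u, u)"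
    using assms unfolding admissible_def by blast
  show ?thesis
  proof (cases rule: c_cases)
    case 0
    show ?thesis
      \<comment> \<open>The quotient goes first: rewriting \<open>w powi c\<close> would destroy the
        pattern of \<open>0(2)\<close>. The matrix has rows (0, -w^2) and (1, 0).\<close>
      using ab unfolding inv 0(2) unfolding 0(1)
      by (elim disjE)
        (rule admissibleI[OF u, of u] admissibleI[OF u, of "-(w\<^sup>2) * u"]; simp; fail)+
  next
    case 1
    show ?thesis
      \<comment> \<open>Rows (1, -1) and (1, 0); the last type keeps its form, with new unit -w^2
        u.\<close>
      using ab unfolding inv 1(2) unfolding 1(1)
      by (elim disjE)
        (rule admissibleI[OF u, of u] admissibleI[OF u, of "-u"]
          admissibleI[OF u, of "-(w\<^sup>2) * u"]; simp add: w algebra_simps w_mult; fail)+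
  next
    case 2
    show ?thesis
      \<comment> \<open>Rows (1 + w, -w) and (1, 0), where 1 + w = -w^2; now (u, u) is
        fixed.\<close>
      using ab unfolding inv 2(2) unfolding 2(1)
      by (elim disjE)
        (rule admissibleI[OF u, of u] admissibleI[OF u, of "-w * u"]
          admissibleI[OF u, of "-(w\<^sup>2) * u"]; simp add: w algebra_simps w_mult; fail)+
  qed
qed

lemma admissible_shift:
  assumes "admissible w (a, b)"
  shows "admissible w (w powi (-1) * (a - b), b)"
proof -
  have inv: "w powi (-1) = w\<^sup>2"
    using w_cube w_nonzero by (simp add: power_int_minus field_simps power3_eq_cube power2_eq_square)
  obtain u where u: "u ^ 6 = 1"
    and ab: "(a, b) = (u, 0) \<or> (a, b) = (0, u) \<or> (a, b) = (u, u) \<or> (a, b) = (-(w\<^sup>2) * u, u)"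
    using assms unfolding admissible_def by blast
  show ?thesis
    using ab unfolding inv
    by (elim disjE)
      (rule admissibleI[OF u, of u] admissibleI[OF u, of "w\<^sup>2 * u"];
        simp add: w algebra_simps w_mult; fail)+
qed

lemma admissible_RS_vec:
  "admissible w (laurent_eval (RS_vec cs $ 1) w, laurent_eval (RS_vec cs $ 2) w)"
proof (induction cs)
  case Nil
  then show ?case by (simp add: RS_vec_Nil admissibleI[of 1 1])
next
  case (Cons c cs)
  from admissible_M_minus[OF this, of c] show ?case
    by (simp add: RS_vec_Cons laurent_eval_diff laurent_eval_mult laurent_eval_q_int
        w_nonzero w_neq_1)
qed

text \<open>The shift mixes both coordinates, so they are followed as a pair; \<open>R_q\<close> and
  \<open>S_q\<close> recurse along the same arguments, hence one induction serves both.\<close>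

lemma admissible_R_q_S_q: "admissible w (laurent_eval (R_q \<alpha>) w, laurent_eval (S_q \<alpha>) w)"
proof (induction \<alpha> rule: S_q.induct)
  case (1 \<alpha>)
  show ?case
  proof (cases "\<alpha> > 1")
    case True
    then show ?thesis
      by (simp add: R_q.simps[of \<alpha>] S_q.simps[of \<alpha>] admissible_RS_vec)
  next
    case False
    from admissible_shift[OF 1[OF this]] False show ?thesis
      by (simp add: R_q.simps[of \<alpha>] S_q.simps[of \<alpha>] laurent_eval_diff laurent_eval_mult w_nonzero)
  qed
qed

lemma admissible_imp_mem:
  assumes "admissible w (a, b)"
  shows "a \<in> {0, 1, -1, w, -w, w\<^sup>2, -(w\<^sup>2)} \<and> b \<in> {0, 1, -1, w, -w, w\<^sup>2, -(w\<^sup>2)}"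
proof -
  have root: "z \<in> {1, -1, w, -w, w\<^sup>2, -(w\<^sup>2)}" if "z ^ 6 = 1" for z
  proof -
    \<comment> \<open>The cyclotomic factorization, with its two quadratic factors split over
      \<open>w\<close>.\<close>
    have "z ^ 6 - 1 = (z - 1) * (z + 1) * ((z - w) * (z - w\<^sup>2)) * ((z + w) * (z + w\<^sup>2))"
    proof -
      have "(z - w) * (z - w\<^sup>2) = z\<^sup>2 + z + 1" "(z + w) * (z + w\<^sup>2) = z\<^sup>2 - z + 1"
        by (simp_all add: w algebra_simps w_mult power2_eq_square)
      then show ?thesis
        by (simp only:) (simp add: algebra_simps power2_eq_square power_numeral_reduce)
    qed
    then show ?thesis
      using that by (auto simp: eq_neg_iff_add_eq_0)
  qed
  have "a = 0 \<or> a ^ 6 = 1" "b = 0 \<or> b ^ 6 = 1"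
    using assms by (auto simp: admissible_def power_mult_distrib w_sq_pow_6
        simp del: power_mult_numeral)
  then show ?thesis using root by blast
qed

end

theorem theorem7p1:
  fixes \<alpha> :: rat and \<omega> :: complex
  assumes "\<omega> = (-1 + csqrt (-3)) / 2"
  shows "laurent_eval (R_q \<alpha>) \<omega> \<in> {0, 1, -1, \<omega>, -\<omega>, \<omega>\<^sup>2, -(\<omega>\<^sup>2)} \<and>
         laurent_eval (S_q \<alpha>) \<omega> \<in> {0, 1, -1, \<omega>, -\<omega>, \<omega>\<^sup>2, -(\<omega>\<^sup>2)}"
proof -
  have "2 * \<omega> + 1 = csqrt (-3)" unfolding assms by (simp add: field_simps)
  \<comment> \<open>Squaring removes the choice of branch and leads to the quadratic relation
    assumed of \<open>w\<close>.\<close>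
  then have "(2 * \<omega> + 1)\<^sup>2 = -3" by (simp only: power2_csqrt)
  then have "4 * (\<omega>\<^sup>2 + \<omega> + 1) = 0"
    by (simp add: power2_eq_square algebra_simps)
  then have "\<omega>\<^sup>2 + \<omega> + 1 = 0" by (simp only: mult_eq_0_iff) simp
  then have "\<omega>\<^sup>2 = - 1 - \<omega>"
    by (simp add: algebra_simps eq_neg_iff_add_eq_0)
  then show ?thesis
    using admissible_R_q_S_q admissible_imp_mem by blast
qed

end
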